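(* Let $A\in\mathbb{R}^{m\times n}$ and $B\in\mathbb{R}^{(n-m)\times n}$ be full-rank matrices satisfying $AB^T=0$, where $2\le m<n$, and let $b\in\mathbb{R}^m$. Let $k$ be an integer with $0\le k\le n$ and suppose that $B^T$ has the range space property (RSP) of order $n-k$ with some constant $\rho>0$. Then a solution $x$ of the system $Ax=b$ obeying $\|x\|_0\le k/2$ is the unique sparsest solution of the linear system.
   Context: $B^T$ satisfies the range space property (RSP) of order $q$ with a constant $\rho>0$ if $\|\xi_{\overline{J}}\|_1\le\rho\|\xi_J\|_1$ for all $\xi\in\mathcal{R}(B^T)$ (the range space of $B^T$), where $J\subseteq\{1,\dots,n\}$ with $|J|=q$ is the set of indices of the $q$ smallest absolute components of $\xi$, $\overline{J}=\{1,\dots,n\}\setminus J$, and $\xi_J$ is the subvector of $\xi$ indexed by $J$. $\|x\|_0$ is the number of nonzero components of $x$. A solution $x$ of $Ax=b$ is the unique sparsest solution if $\|x\|_0<\|y\|_0$ for every solution $y\ne x$ of $Ay=b$. *)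

theory Defs
  imports "HOL-Analysis.Analysis"
begin

definition full_rank :: "real ^ 'n ^ 'm \<Rightarrow> bool" where
  "full_rank A \<longleftrightarrow> rank A = min CARD('m) CARD('n)"

definition l0 :: "real ^ 'n \<Rightarrow> nat" where
  "l0 x = card {i. x $ i \<noteq> 0}"

text \<open>The 1-norm of the subvector of \<open>x\<close> indexed by \<open>S\<close>.\<close>

definition l1_on :: "'n set \<Rightarrow> real ^ 'n \<Rightarrow> real" where
  "l1_on S x = (\<Sum>i\<in>S. \<bar>x $ i\<bar>)"

text \<open>
  With ties among the absolute components, several sets \<open>J\<close> qualify; the 1-norms of the
  subvectors of \<open>x\<close> on \<open>J\<close> and on its complement are the same for all of them.
\<close>

definition smallest_indices :: "nat \<Rightarrow> real ^ 'n \<Rightarrow> 'n set \<Rightarrow> bool" where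
  "smallest_indices q x J \<longleftrightarrow>
     card J = q \<and> (\<forall>i\<in>J. \<forall>j\<in>-J. \<bar>x $ i\<bar> \<le> \<bar>x $ j\<bar>)"

definition rsp :: "real ^ 'p ^ 'n \<Rightarrow> nat \<Rightarrow> real \<Rightarrow> bool" where
  "rsp M q \<rho> \<longleftrightarrow>
     (\<forall>\<xi>\<in>range (\<lambda>u. M *v u). \<forall>J. smallest_indices q \<xi> J \<longrightarrow>
        l1_on (-J) \<xi> \<le> \<rho> * l1_on J \<xi>)"

definition unique_sparsest_solution :: "real ^ 'n ^ 'm \<Rightarrow> real ^ 'm \<Rightarrow> real ^ 'n \<Rightarrow> bool" where
  "unique_sparsest_solution A b x \<longleftrightarrow>
     A *v x = b \<and> (\<forall>y. A *v y = b \<and> y \<noteq> x \<longrightarrow> l0 x < l0 y)"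

end

theory Submission imports Defs begin

text \<open>
  If \<open>x\<close> and \<open>y\<close> solve the same system, then \<open>z = y - x\<close> lies in the null space of \<open>A\<close>,
  and this null space is the range of \<open>transpose B\<close>: the inclusion of the range is the hypothesis
  \<open>A ** transpose B = 0\<close>, and the rank-nullity theorem makes the dimensions agree
  (\<open>null_space_eq_range_transpose\<close>).  If \<open>l0 y \<le> l0 x\<close>, then \<open>z\<close> has at most \<open>2 * l0 x \<le> k\<close>
  nonzero components, so at least \<open>n - k\<close> of its components vanish, where \<open>n = CARD('n)\<close>, and these
  are smallest in absolute value.  The range space property then bounds the 1-norm of the remaining
  components by \<open>\<rho>\<close> times zero, so \<open>z = 0\<close> (\<open>rsp_sparse_vector_eq_zero\<close>) and \<open>y = x\<close>.
\<close>

text \<open>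
  The null space of \<open>A\<close> is the orthogonal complement of the range of \<open>transpose A\<close>, which has
  dimension \<open>rank A\<close>.
\<close>

lemma dim_null_space_plus_rank:
  fixes A :: "real ^ 'n ^ 'm"
  shows "dim {z. A *v z = 0} + rank A = CARD('n)"
proof -
  let ?R = "range (\<lambda>u. transpose A *v u)"
  have "(\<forall>w\<in>?R. orthogonal w z) \<longleftrightarrow> A *v z = 0" for z
    by (simp add: orthogonal_def dot_lmul_matrix vector_eq_ldot[of _ 0, simplified])
  then have "{z. A *v z = 0} = {z \<in> UNIV. \<forall>w\<in>?R. orthogonal w z}"
    by simp
  moreover have "dim {z \<in> UNIV. \<forall>w\<in>?R. orthogonal w z} + dim ?R = dim (UNIV :: (real ^ 'n) set)"
    by (intro dim_subspace_orthogonal_to_vectors linear_subspace_image matrix_vector_mul_linear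
        subspace_UNIV subset_UNIV)
  moreover have "dim ?R = rank A"
    using rank_dim_range[of "transpose A"] by (simp add: rank_transpose)
  ultimately show ?thesis
    by simp
qed

text \<open>
  The range is contained in the null space because the product vanishes.  Both have dimension
  \<open>CARD('n) - CARD('m)\<close>: the null space by rank-nullity, the range since transposing preserves
  the rank.
\<close>

lemma null_space_eq_range_transpose:
  fixes A :: "real ^ 'n ^ 'm" and B :: "real ^ 'n ^ 'p"
  assumes "CARD('m) \<le> CARD('n)"
    and "CARD('p) = CARD('n) - CARD('m)"
    and "full_rank A" and "full_rank B"
    and "A ** transpose B = 0"
  shows "{z. A *v z = 0} = range (\<lambda>u. transpose B *v u)"
proof -
  let ?R = "range (\<lambda>u. transpose B *v u)" and ?N = "{z. A *v z = 0}"
  have "A *v (transpose B *v u) = 0" for u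
    using assms(5) by (simp only: matrix_vector_mul_assoc matrix_vector_mult_0)
  then have "?R \<subseteq> ?N"
    by auto
  moreover have "subspace ?R"
    by (intro linear_subspace_image matrix_vector_mul_linear subspace_UNIV)
  moreover have "subspace ?N"
    by (intro linear_subspace_kernel matrix_vector_mul_linear)
  moreover have "dim ?N \<le> dim ?R"
  proof -
    have "rank A = CARD('m)" "rank B = CARD('p)"
      using assms by (auto simp: full_rank_def)
    moreover have "dim ?R = rank B"
      using rank_dim_range[of "transpose B"] by (simp add: rank_transpose)
    moreover have "dim ?N + rank A = CARD('n)"
      by (rule dim_null_space_plus_rank)
    ultimately show ?thesis
      using assms(2) by simp
  qed
  ultimately show ?thesis
    using subspace_dim_equal by metis
qed

lemma l0_diff_le: "l0 (y - x) \<le> l0 y + l0 x"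
proof -
  have "l0 (y - x) \<le> card ({i. y $ i \<noteq> 0} \<union> {i. x $ i \<noteq> 0})"
    unfolding l0_def by (intro card_mono) auto
  also have "\<dots> \<le> l0 y + l0 x"
    unfolding l0_def by (rule card_Un_le)
  finally show ?thesis .
qed

text \<open>
  The range space property applies to any set of \<open>q\<close> smallest components; when \<open>q\<close> components
  vanish, it can be taken inside the zero set, where the bounding 1-norm is zero.
\<close>

lemma rsp_sparse_vector_eq_zero:
  fixes M :: "real ^ 'p ^ 'n"
  assumes "rsp M q \<rho>" and "z \<in> range (\<lambda>u. M *v u)" and "q + l0 z \<le> CARD('n)"
  shows "z = 0"
proof -
  have "{i. z $ i = 0} = - {i. z $ i \<noteq> 0}"
    by auto
  then have "q \<le> card {i. z $ i = 0}"
    using assms(3) by (simp add: l0_def Compl_eq_Diff_UNIV card_Diff_subset)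
  then obtain J where J: "J \<subseteq> {i. z $ i = 0}" "card J = q"
    by (meson obtain_subset_with_card_n)
  then have zero: "z $ i = 0" if "i \<in> J" for i
    using that by blast
  have "smallest_indices q z J"
    using J(2) zero by (simp add: smallest_indices_def)
  with assms(1,2) have "l1_on (- J) z \<le> \<rho> * l1_on J z"
    unfolding rsp_def by blast
  also have "\<dots> = 0"
    by (simp add: l1_on_def zero)
  finally have "(\<Sum>i\<in>-J. \<bar>z $ i\<bar>) = 0"
    by (simp add: l1_on_def antisym sum_nonneg)
  then have "\<forall>i\<in>-J. z $ i = 0"
    by (simp add: sum_nonneg_eq_0_iff)
  with zero show ?thesis
    by (auto simp: vec_eq_iff)
qed

theorem theorem6p2:
  fixes A :: "real ^ 'n ^ 'm" and B :: "real ^ 'n ^ 'p"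
    and b :: "real ^ 'm" and x :: "real ^ 'n" and k :: nat
  assumes "2 \<le> CARD('m)" and "CARD('m) < CARD('n)"
    and "CARD('p) = CARD('n) - CARD('m)"
    and "full_rank A" and "full_rank B"
    and "A ** transpose B = 0"
    and "k \<le> CARD('n)"
    and "\<exists>\<rho>>0. rsp (transpose B) (CARD('n) - k) \<rho>"
    and "A *v x = b"
    and "real (l0 x) \<le> real k / 2"
  shows "unique_sparsest_solution A b x"
proof -
  obtain \<rho> where \<rho>: "rsp (transpose B) (CARD('n) - k) \<rho>"
    using assms(8) by blast
  have "l0 x < l0 y" if y: "A *v y = b" "y \<noteq> x" for y
  proof (rule ccontr)
    assume "\<not> l0 x < l0 y"
    then have "l0 (y - x) \<le> k"
      using l0_diff_le[of y x] assms(10) by linarith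
    moreover have "y - x \<in> range (\<lambda>u. transpose B *v u)"
      using null_space_eq_range_transpose[of A B] assms y(1)
      by (auto simp: matrix_vector_mult_diff_distrib)
    ultimately have "y - x = 0"
      using assms(7) by (intro rsp_sparse_vector_eq_zero[OF \<rho>]) auto
    with y(2) show False
      by simp
  qed
  with assms(9) show ?thesis
    by (simp add: unique_sparsest_solution_def)
qed

end
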